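(* Let $\mathbf a=(a_1,\dots,a_{r+1})^{\mathrm T}\in\mathbb R^{r+1}$ be a fixed nonzero vector, and let $t$ be the maximal multiplicity of roots of the polynomial $g_{\mathbf a}(z)=\sum_{k=0}^{r}a_{k+1}z^k$ on the unit circle $\mathbb T=\{z\in\mathbb C:|z|=1\}$ ($t=0$ if there are none). For $N>r$ and real $\alpha$, denote by $\lambda_{\min}(\alpha)$ and $\lambda_{\max}(\alpha)$ the eigenvalues of the $N\times N$ circulant matrix $\mathbf C(\tilde{\mathbf a}(\alpha))$ of minimal and maximal absolute value, respectively. Then, as $N\to\infty$: 1. for any real sequence $\alpha=\alpha(N)$, $|\lambda_{\min}(\alpha)|=O(N^{-t})$; 2. for any real sequence $\alpha=\alpha(N)$, $|\lambda_{\max}(\alpha)|=\Theta(1)$; 3. there exists a real sequence $\alpha=\alpha(N)$ such that $|\lambda_{\min}(\alpha)|=\Theta(N^{-t})$.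
   Context: For $\mathbf b=(b_1,\dots,b_{r+1})^{\mathrm T}\in\mathbb C^{r+1}$ and $N>r$, $\mathbf C(\mathbf b)\in\mathbb C^{N\times N}$ is the circulant matrix whose first row is $(b_1,b_2,\dots,b_{r+1},0,\dots,0)$ and in which each subsequent row is the cyclic shift of the previous row by one position to the right. For real $\alpha$, $\tilde{\mathbf a}(\alpha)=\operatorname{diag}(1,e^{-\mathrm i\alpha},\dots,e^{-\mathrm i r\alpha})\,\mathbf a$, i.e. its $(k+1)$-th entry is $e^{-\mathrm ik\alpha}a_{k+1}$. "$O$" is an upper bound on the order as $N\to\infty$; "$\Theta$" is the exact order (bounded above and below by positive constant multiples for all large $N$). *)

theory Defs
  imports
    "Jordan_Normal_Form.Spectral_Radius"
    "HOL-Library.Landau_Symbols"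
begin

text \<open>
  Vectors are indexed from 0, so the entry \<open>a $ k\<close> is $a_{k+1}$ of the usual 1-based notation.
\<close>

definition gen_poly :: "real vec \<Rightarrow> complex poly" where
  "gen_poly a = (\<Sum>k<dim_vec a. monom (complex_of_real (a $ k)) k)"

text \<open>
  Inserting 0 only matters when there is no root on the unit circle: a root has positive order.
  The set is finite, so that \<^const>\<open>Max\<close> is meaningful, as soon as \<open>p \<noteq> 0\<close>.
\<close>

definition max_mult_unit_circle :: "complex poly \<Rightarrow> nat" where
  "max_mult_unit_circle p = Max (insert 0 {order z p | z. cmod z = 1 \<and> poly p z = 0})"

definition modulate :: "real \<Rightarrow> real vec \<Rightarrow> complex vec" where
  "modulate \<alpha> a =
     vec (dim_vec a) (\<lambda>k. exp (- (\<i> * of_nat k * complex_of_real \<alpha>)) * complex_of_real (a $ k))"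

text \<open>
  Meant for \<open>dim_vec b \<le> N\<close>. The index \<open>(j + N - i) mod N\<close> is \<open>j - i\<close> modulo \<open>N\<close>, written
  so as to avoid truncated subtraction; the two lemmas below recover the description by the
  first row and by cyclic shifts to the right.
\<close>

definition circulant :: "nat \<Rightarrow> complex vec \<Rightarrow> complex mat" where
  "circulant N b = mat N N (\<lambda>(i, j).
     let k = (j + N - i) mod N in if k < dim_vec b then b $ k else 0)"

lemma circulant_first_row:
  assumes "j < N"
  shows "circulant N b $$ (0, j) = (if j < dim_vec b then b $ j else 0)"
  using assms by (simp add: circulant_def)

lemma circulant_shift:
  assumes "Suc i < N" "j < N"
  shows "circulant N b $$ (Suc i, Suc j mod N) = circulant N b $$ (i, j)"
proof -
  have "(Suc j mod N + N - Suc i) mod N = (j + N - i) mod N"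
  proof (cases "Suc j = N")
    case True
    then have "j + N - i = N + (N - Suc i)" using assms by simp
    moreover have "Suc j mod N + N - Suc i = N - Suc i" using True by simp
    ultimately show ?thesis by (simp only: mod_add_self1)
  next
    case False
    then show ?thesis using assms by simp
  qed
  then show ?thesis using assms by (simp add: circulant_def Let_def)
qed

text \<open>
  An eigenvalue of extremal modulus need not be unique; one is chosen, and its modulus does not
  depend on the choice.
\<close>

definition lambda_min :: "complex mat \<Rightarrow> complex" where
  "lambda_min A = arg_min cmod (\<lambda>x. eigenvalue A x)"

definition lambda_max :: "complex mat \<Rightarrow> complex" where
  "lambda_max A = arg_max cmod (\<lambda>x. eigenvalue A x)"

end

(* Writing g for gen_poly a, the eigenvalues of the circulant matrix are the values g(z) at the
   solutions z of z^N = exp(-i N alpha). Every point of the unit circle has such a z within distance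
   2 pi / N; applied to a root of multiplicity t this bounds the smallest eigenvalue from above, and
   applied to a point where g does not vanish it bounds the largest from below. For the
   third part, |z^N - w^N| <= N |z - w| on the circle, so every z stays at distance of order 1/N
   from the roots w of g on the circle as soon as exp(-i N alpha) keeps a fixed distance from the finitely
   many points w^N. *)

theory Submission
  imports "HOL-Analysis.Complex_Transcendental" Defs
begin

unbundle no vec_syntax

section \<open>Eigenvalues of circulant matrices\<close>

lemma power_mod_unity:
  fixes w :: "'a::monoid_mult"
  assumes "w ^ N = 1"
  shows "w ^ (m mod N) = w ^ m"
proof -
  have "w ^ m = w ^ (N * (m div N) + m mod N)" by simp
  also have "\<dots> = w ^ (m mod N)" by (simp only: power_add power_mult assms) simp
  finally show ?thesis by simp
qed

lemma sum_circulant_entries: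
  fixes f :: "nat \<Rightarrow> complex"
  assumes "dim_vec b \<le> N"
  shows "(\<Sum>k<N. (if k < dim_vec b then b $ k else 0) * f k) = (\<Sum>k<dim_vec b. b $ k * f k)"
  using assms by (intro sum.mono_neutral_cong_right) auto

text \<open>Substituting k = j - i modulo \<open>N\<close> leaves \<open>w ^ j\<close> equal to
  \<open>w ^ (k + i)\<close>, as \<open>w\<close> is an \<open>N\<close>-th root of unity. In other
  words, the vector of powers of \<open>w\<close> is a right eigenvector.\<close>

lemma circulant_row_sum:
  assumes w: "w ^ N = 1" and b: "dim_vec b \<le> N" and i: "i < N"
  shows "(\<Sum>j<N. circulant N b $$ (i, j) * w ^ j) = (\<Sum>k<dim_vec b. b $ k * w ^ k) * w ^ i"
proof -
  define c where "c k = (if k < dim_vec b then b $ k else 0)" for k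
  have "(\<Sum>j<N. circulant N b $$ (i, j) * w ^ j) = (\<Sum>j<N. c ((j + N - i) mod N) * w ^ j)"
    using i by (intro sum.cong) (auto simp: circulant_def c_def Let_def)
  also have "\<dots> = (\<Sum>k<N. c k * w ^ (k + i))"
  proof (rule sum.reindex_bij_witness[of _ "\<lambda>k. (k + i) mod N" "\<lambda>j. (j + N - i) mod N"])
    fix j assume j: "j \<in> {..<N}"
    have *: "((j + N - i) mod N + i) mod N = j"
      using i j by (simp add: mod_add_left_eq)
    then show "((j + N - i) mod N + i) mod N = j" .
    have "w ^ ((j + N - i) mod N + i) = w ^ (((j + N - i) mod N + i) mod N)"
      by (rule power_mod_unity[OF w, symmetric])
    then show "c ((j + N - i) mod N) * w ^ ((j + N - i) mod N + i) = c ((j + N - i) mod N) * w ^ j"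
      by (simp only: *)
  next
    fix k assume k: "k \<in> {..<N}"
    show "((k + i) mod N + N - i) mod N = k"
    proof -
      have "((k + i) mod N + N - i) mod N = ((k + i) mod N + (N - i)) mod N" using i by simp
      also have "\<dots> = (k + i + (N - i)) mod N" by (rule mod_add_left_eq)
      also have "\<dots> = k" using i k by simp
      finally show ?thesis .
    qed
  qed (use i in auto)
  also have "\<dots> = (\<Sum>k<N. c k * w ^ k) * w ^ i"
    unfolding sum_distrib_right by (simp only: power_add mult_ac)
  finally show ?thesis
    unfolding c_def sum_circulant_entries[OF b] .
qed

text \<open>The counterpart for left eigenvectors, with the powers of \<open>inverse w\<close>. It
  serves to show that there are no eigenvalues besides those found with right eigenvectors.\<close>

lemma circulant_col_sum:
  assumes w: "w ^ N = 1" and b: "dim_vec b \<le> N" and j: "j < N"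
  shows "(\<Sum>i<N. inverse w ^ i * circulant N b $$ (i, j)) =
    (\<Sum>k<dim_vec b. b $ k * w ^ k) * inverse w ^ j"
proof -
  define c where "c k = (if k < dim_vec b then b $ k else 0)" for k
  have w': "inverse w ^ N = 1" using w by (simp add: power_inverse)
  have w0: "w \<noteq> 0" using w j by (auto simp: power_0_left)
  \<comment> \<open>For fixed \<open>j\<close>, the map from i to j - i modulo \<open>N\<close> is
    an involution, so it is its own inverse in the reindexing below.\<close>
  have inv: "(j + N - (j + N - i) mod N) mod N = i" if "i < N" for i
  proof (cases "i \<le> j")
    case True
    then have "(j + N - i) mod N = j - i"
      using j by (simp add: mod_if)
    then show ?thesis using True that by simp
  next
    case False
    then have "(j + N - i) mod N = j + N - i" using that by simp
    then show ?thesis using False that by simp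
  qed
  have "(\<Sum>i<N. inverse w ^ i * circulant N b $$ (i, j)) =
      (\<Sum>i<N. inverse w ^ i * c ((j + N - i) mod N))"
    using j by (intro sum.cong) (auto simp: circulant_def c_def Let_def)
  also have "\<dots> = (\<Sum>k<N. inverse w ^ (j + N - k) * c k)"
  proof (rule sum.reindex_bij_witness[of _ "\<lambda>k. (j + N - k) mod N" "\<lambda>i. (j + N - i) mod N"])
    fix i assume i: "i \<in> {..<N}"
    have "inverse w ^ (j + N - (j + N - i) mod N) = inverse w ^ ((j + N - (j + N - i) mod N) mod N)"
      by (rule power_mod_unity[OF w', symmetric])
    then show "inverse w ^ (j + N - (j + N - i) mod N) * c ((j + N - i) mod N) =
        inverse w ^ i * c ((j + N - i) mod N)"
      using i by (simp only: inv lessThan_iff)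
  qed (use j inv in auto)
  also have "\<dots> = (\<Sum>k<N. c k * w ^ k * inverse w ^ j)"
  proof (intro sum.cong refl)
    fix k assume "k \<in> {..<N}"
    then have "inverse w ^ (j + N - k) * inverse w ^ k = inverse w ^ j"
      using w' by (simp flip: power_add) (simp add: power_add)
    then have "inverse w ^ (j + N - k) = w ^ k * inverse w ^ j"
      using w0 by (simp add: power_inverse field_simps)
    then show "inverse w ^ (j + N - k) * c k = c k * w ^ k * inverse w ^ j"
      by simp
  qed
  also have "\<dots> = (\<Sum>k<N. c k * w ^ k) * inverse w ^ j"
    by (simp add: sum_distrib_right)
  finally show ?thesis
    unfolding c_def sum_circulant_entries[OF b] .
qed

lemma eigenvalue_circulant_iff:
  assumes N: "0 < N" and b: "dim_vec b \<le> N"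
  shows "eigenvalue (circulant N b) x \<longleftrightarrow>
    (\<exists>w. w ^ N = 1 \<and> x = (\<Sum>k<dim_vec b. b $ k * w ^ k))"
proof
  have carr: "circulant N b \<in> carrier_mat N N" by (simp add: circulant_def)
  assume "\<exists>w. w ^ N = 1 \<and> x = (\<Sum>k<dim_vec b. b $ k * w ^ k)"
  then obtain w where w: "w ^ N = 1" and x: "x = (\<Sum>k<dim_vec b. b $ k * w ^ k)" by blast
  define v where "v = vec N (\<lambda>j. w ^ j)"
  have "v $ 0 \<noteq> 0\<^sub>v N $ 0" using N by (simp add: v_def)
  then have "v \<noteq> 0\<^sub>v N" by auto
  moreover have "circulant N b *\<^sub>v v = x \<cdot>\<^sub>v v"
  proof (rule eq_vecI)
    fix i assume "i < dim_vec (x \<cdot>\<^sub>v v)"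
    then have i: "i < N" by (simp add: v_def)
    have "(circulant N b *\<^sub>v v) $ i = (\<Sum>j<N. circulant N b $$ (i, j) * w ^ j)"
      using i carr by (simp add: v_def scalar_prod_def lessThan_atLeast0)
    then show "(circulant N b *\<^sub>v v) $ i = (x \<cdot>\<^sub>v v) $ i"
      using circulant_row_sum[OF w b i] i by (simp add: x v_def)
  qed (use carr in \<open>auto simp: v_def\<close>)
  ultimately have "eigenvector (circulant N b) v x"
    using carr by (simp add: eigenvector_def v_def)
  then show "eigenvalue (circulant N b) x" unfolding eigenvalue_def by blast
next
  have carr: "circulant N b \<in> carrier_mat N N" by (simp add: circulant_def)
  assume "eigenvalue (circulant N b) x"
  then obtain v where v: "v \<in> carrier_vec N" "v \<noteq> 0\<^sub>v N" "circulant N b *\<^sub>v v = x \<cdot>\<^sub>v v"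
    using carr by (auto simp: eigenvalue_def eigenvector_def)
  \<comment> \<open>The value of \<open>p\<close> at \<open>u\<close> is the pairing of
    \<open>v\<close> with the row of powers of \<open>u\<close>.\<close>
  define p where "p = (\<Sum>i<N. monom (v $ i) i)"
  have p_coeff: "coeff p i = v $ i" if "i < N" for i
    using that by (simp add: p_def coeff_sum sum.delta)
  obtain i where "i < N" "v $ i \<noteq> 0"
    using v by (metis carrier_vecD eq_vecI index_zero_vec)
  then have "p \<noteq> 0" using p_coeff by force
  have "degree p < N"
    unfolding p_def using N
    by (intro le_less_trans[OF degree_sum_le, of _ _ "N - 1"])
      (auto intro: order_trans[OF degree_monom_le])
  \<comment> \<open>A nonzero polynomial of degree below \<open>N\<close> cannot vanish at all
    \<open>N\<close> roots of unity.\<close>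
  have "\<exists>u. u ^ N = 1 \<and> poly p u \<noteq> 0"
  proof (rule ccontr)
    assume "\<not> ?thesis"
    then have "{u. u ^ N = 1} \<subseteq> {u. poly p u = 0}" by auto
    then have "N \<le> card {u. poly p u = 0}"
      using card_mono[OF poly_roots_finite[OF \<open>p \<noteq> 0\<close>]] card_roots_unity_eq[OF N] by metis
    with card_poly_roots_bound[OF \<open>p \<noteq> 0\<close>] \<open>degree p < N\<close> show False by simp
  qed
  then obtain u where u: "u ^ N = 1" "poly p u \<noteq> 0" by blast
  define w where "w = inverse u"
  have w: "w ^ N = 1" and uw: "u = inverse w" using u by (auto simp: w_def power_inverse)
  have pu: "poly p u = (\<Sum>i<N. v $ i * u ^ i)" by (simp add: p_def poly_sum poly_monom)
  have "x * poly p u = (\<Sum>i<N. u ^ i * (x \<cdot>\<^sub>v v) $ i)"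
    using v(1) by (simp add: pu sum_distrib_left mult_ac)
  also have "\<dots> = (\<Sum>i<N. u ^ i * (\<Sum>j<N. circulant N b $$ (i, j) * v $ j))"
    using carr v(1) by (simp flip: v(3)) (simp add: scalar_prod_def lessThan_atLeast0)
  also have "\<dots> = (\<Sum>j<N. (\<Sum>i<N. u ^ i * circulant N b $$ (i, j)) * v $ j)"
    unfolding sum_distrib_left sum_distrib_right by (subst sum.swap) (simp add: mult_ac)
  also have "\<dots> = (\<Sum>j<N. (\<Sum>k<dim_vec b. b $ k * w ^ k) * u ^ j * v $ j)"
    unfolding uw using circulant_col_sum[OF w b] by simp
  also have "\<dots> = (\<Sum>k<dim_vec b. b $ k * w ^ k) * poly p u"
    unfolding pu sum_distrib_left by (simp only: mult_ac)
  finally show "\<exists>w. w ^ N = 1 \<and> x = (\<Sum>k<dim_vec b. b $ k * w ^ k)"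
    using u(2) w by auto
qed

section \<open>Specialization to the modulated vector\<close>

lemma poly_gen_poly: "poly (gen_poly a) z = (\<Sum>k<dim_vec a. complex_of_real (a $ k) * z ^ k)"
  by (simp add: gen_poly_def poly_sum poly_monom)

lemma gen_poly_nonzero:
  assumes "a \<in> carrier_vec n" "a \<noteq> 0\<^sub>v n"
  shows "gen_poly a \<noteq> 0"
proof -
  obtain i where i: "i < n" "a $ i \<noteq> 0"
    using assms by (metis carrier_vecD eq_vecI index_zero_vec)
  then have "coeff (gen_poly a) i = a $ i"
    using assms(1) by (simp add: gen_poly_def coeff_sum sum.delta)
  with i show ?thesis by auto
qed

text \<open>Modulating the coefficients amounts to rotating the argument of the polynomial by
  \<open>cis (- \<alpha>)\<close>, and this rotation carries the \<open>N\<close>-th roots of unity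
  to the \<open>N\<close>-th roots of \<open>cis (- (real N * \<alpha>))\<close>.\<close>

lemma eigenvalue_circulant_modulate:
  assumes N: "0 < N" "dim_vec a \<le> N"
  shows "eigenvalue (circulant N (modulate \<alpha> a)) x \<longleftrightarrow>
    (\<exists>z. z ^ N = cis (- (real N * \<alpha>)) \<and> x = poly (gen_poly a) z)"
proof -
  have dim: "dim_vec (modulate \<alpha> a) = dim_vec a" by (simp add: modulate_def)
  have eq: "(\<Sum>k<dim_vec a. modulate \<alpha> a $ k * w ^ k) = poly (gen_poly a) (cis (- \<alpha>) * w)" for w
    unfolding poly_gen_poly
  proof (intro sum.cong refl)
    fix k assume "k \<in> {..<dim_vec a}"
    moreover have "exp (- (\<i> * of_nat k * complex_of_real \<alpha>)) = cis (- \<alpha>) ^ k"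
      by (simp add: cis_conv_exp mult_ac flip: exp_of_nat_mult)
    ultimately show "modulate \<alpha> a $ k * w ^ k = complex_of_real (a $ k) * (cis (- \<alpha>) * w) ^ k"
      by (simp add: modulate_def power_mult_distrib)
  qed
  have "(\<exists>w. w ^ N = 1 \<and> x = poly (gen_poly a) (cis (- \<alpha>) * w)) \<longleftrightarrow>
    (\<exists>z. z ^ N = cis (- (real N * \<alpha>)) \<and> x = poly (gen_poly a) z)"
  proof safe
    fix w :: complex assume "w ^ N = 1"
    then show "\<exists>z. z ^ N = cis (- (real N * \<alpha>)) \<and>
        poly (gen_poly a) (cis (- \<alpha>) * w) = poly (gen_poly a) z"
      by (intro exI[of _ "cis (- \<alpha>) * w"]) (simp add: power_mult_distrib Complex.DeMoivre)
  next
    fix z assume "z ^ N = cis (- (real N * \<alpha>))"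
    then show "\<exists>w. w ^ N = 1 \<and> poly (gen_poly a) z = poly (gen_poly a) (cis (- \<alpha>) * w)"
      by (intro exI[of _ "cis \<alpha> * z"])
        (simp add: power_mult_distrib Complex.DeMoivre cis_mult flip: mult.assoc)
  qed
  then show ?thesis using eigenvalue_circulant_iff[of N "modulate \<alpha> a" x] N by (simp add: dim eq)
qed

section \<open>Extremal eigenvalues\<close>

text \<open>The spectrum is finite and, in positive dimension, nonempty, so the minimum is attained
  and the choice operator returns a minimizer.\<close>

lemma lambda_min:
  assumes "A \<in> carrier_mat n n" "0 < n"
  shows eigenvalue_lambda_min: "eigenvalue A (lambda_min A)"
    and lambda_min_le: "eigenvalue A x \<Longrightarrow> cmod (lambda_min A) \<le> cmod x"
proof -
  have "\<exists>x. is_arg_min cmod (\<lambda>x. x \<in> spectrum A) x"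
    using assms by (intro ex_is_arg_min_if_finite card_finite_spectrum spectrum_non_empty) auto
  then have "is_arg_min cmod (eigenvalue A) (lambda_min A)"
    unfolding lambda_min_def arg_min_def spectrum_def by (auto intro: someI_ex)
  then show "eigenvalue A (lambda_min A)" "eigenvalue A x \<Longrightarrow> cmod (lambda_min A) \<le> cmod x"
    by (auto simp: is_arg_min_linorder)
qed

lemma lambda_max:
  assumes "A \<in> carrier_mat n n" "0 < n"
  shows eigenvalue_lambda_max: "eigenvalue A (lambda_max A)"
    and lambda_max_ge: "eigenvalue A x \<Longrightarrow> cmod x \<le> cmod (lambda_max A)"
proof -
  have "\<exists>x. is_arg_min (\<lambda>x. - cmod x) (\<lambda>x. x \<in> spectrum A) x"
    using assms by (intro ex_is_arg_min_if_finite card_finite_spectrum spectrum_non_empty) auto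
  then have "\<exists>x. is_arg_max cmod (eigenvalue A) x"
    by (auto simp: is_arg_min_def is_arg_max_def spectrum_def)
  then have "is_arg_max cmod (eigenvalue A) (lambda_max A)"
    unfolding lambda_max_def arg_max_def by (auto intro: someI_ex)
  then show "eigenvalue A (lambda_max A)" "eigenvalue A x \<Longrightarrow> cmod x \<le> cmod (lambda_max A)"
    by (auto simp: is_arg_max_linorder)
qed

section \<open>Roots of a unimodular number\<close>

text \<open>A chord is no longer than its arc: its exact length is twice the absolute sine of half
  the angle.\<close>

lemma dist_cis_le: "dist (cis x) (cis y) \<le> \<bar>x - y\<bar>"
proof -
  have "cis x - cis y = cis y * (exp (\<i> * of_real (x - y)) - 1)"
    by (simp add: right_diff_distrib cis_mult cis_conv_exp[symmetric] del: of_real_diff)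
  then have "dist (cis x) (cis y) = 2 * \<bar>sin ((x - y) / 2)\<bar>"
    by (simp add: dist_norm norm_mult dist_exp_i_1 del: of_real_diff)
  also have "\<dots> \<le> \<bar>x - y\<bar>"
    using abs_sin_x_le_abs_x[of "(x - y) / 2"] by simp
  finally show ?thesis .
qed

lemma nearby_nth_root:
  assumes "cmod z0 = 1" "cmod u = 1" "0 < N"
  obtains z where "z ^ N = u" "dist z z0 \<le> 2 * pi / real N"
proof -
  define \<theta> \<phi> where "\<theta> = Arg z0" and "\<phi> = Arg u"
  have z0: "z0 = cis \<theta>" and u: "u = cis \<phi>"
    unfolding \<theta>_def \<phi>_def using assms(1,2)
    by (metis cis_Arg norm_zero zero_neq_one sgn_eq div_by_1 of_real_1)+
  \<comment> \<open>Admissible arguments of \<open>z\<close> are spaced by 2 pi / \<open>N\<close>.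
    The floor selects the last one that does not exceed \<open>\<theta>\<close>.\<close>
  define n where "n = \<lfloor>(real N * \<theta> - \<phi>) / (2 * pi)\<rfloor>"
  define z where "z = cis ((\<phi> + 2 * pi * of_int n) / real N)"
  have "of_int n \<le> (real N * \<theta> - \<phi>) / (2 * pi)" "(real N * \<theta> - \<phi>) / (2 * pi) < of_int n + 1"
    unfolding n_def by linarith+
  then have "2 * pi * of_int n \<le> real N * \<theta> - \<phi>" "real N * \<theta> - \<phi> < 2 * pi * of_int n + 2 * pi"
    by (simp_all add: field_simps)
  then have "\<bar>\<phi> + 2 * pi * of_int n - real N * \<theta>\<bar> / real N \<le> 2 * pi / real N"
    by (intro divide_right_mono) (auto simp: abs_le_iff)
  moreover have "(\<phi> + 2 * pi * of_int n) / real N - \<theta> = (\<phi> + 2 * pi * of_int n - real N * \<theta>) / real N"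
    using assms(3) by (simp add: diff_divide_distrib)
  ultimately have "\<bar>(\<phi> + 2 * pi * of_int n) / real N - \<theta>\<bar> \<le> 2 * pi / real N"
    by simp
  then have "dist z z0 \<le> 2 * pi / real N"
    unfolding z_def z0 by (rule order_trans[OF dist_cis_le])
  moreover have "z ^ N = u"
    using assms(3) by (simp add: z_def Complex.DeMoivre u flip: cis_mult)
  ultimately show ?thesis using that by blast
qed

section \<open>Size of a polynomial on the unit circle\<close>

lemma order_le_max_mult_unit_circle:
  assumes "p \<noteq> 0" "cmod z = 1"
  shows "order z p \<le> max_mult_unit_circle p"
proof (cases "poly p z = 0")
  case True
  have "finite {order z p | z. cmod z = 1 \<and> poly p z = 0}"
    using poly_roots_finite[OF assms(1)] by simp
  then show ?thesis unfolding max_mult_unit_circle_def using True assms(2) by (intro Max_ge) auto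
qed (simp add: order_root)

text \<open>If the maximum is the inserted 0, there need not be a root to take; every point of the
  circle then has order 0, and 1 serves as witness. This spares later arguments a separate case
  \<open>t = 0\<close>.\<close>

lemma max_mult_unit_circle_attained:
  assumes "p \<noteq> 0"
  obtains z where "cmod z = 1" "order z p = max_mult_unit_circle p"
proof -
  have fin: "finite {order z p | z. cmod z = 1 \<and> poly p z = 0}"
    using poly_roots_finite[OF assms(1)] by simp
  have "max_mult_unit_circle p \<in> insert 0 {order z p | z. cmod z = 1 \<and> poly p z = 0}"
    unfolding max_mult_unit_circle_def using fin by (intro Max_in) auto
  then consider "max_mult_unit_circle p = 0" | "\<exists>z. cmod z = 1 \<and> order z p = max_mult_unit_circle p"
    unfolding insert_iff mem_Collect_eq by metis
  then show ?thesis
  proof cases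
    case 1
    then have "order 1 p = max_mult_unit_circle p"
      using order_le_max_mult_unit_circle[OF assms, of 1] by simp
    then show ?thesis by (intro that[of 1]) auto
  qed (use that in blast)
qed

lemma poly_bound_unit_circle:
  fixes p :: "complex poly"
  obtains M where "M > 0" "\<And>z. cmod z = 1 \<Longrightarrow> cmod (poly p z) \<le> M"
proof -
  have "compact (poly p ` sphere 0 1)"
    by (intro compact_continuous_image continuous_intros) auto
  then have "bounded (poly p ` sphere 0 1)" by (rule compact_imp_bounded)
  then obtain M where "M > 0" "\<forall>x\<in>poly p ` sphere 0 1. cmod x \<le> M"
    by (auto simp: bounded_pos)
  then show ?thesis by (intro that[of M]) auto
qed

text \<open>
  Factoring out all unit-circle roots at once would only give an exponent equal to the total
  multiplicity; a compactness argument, one point of the circle at a time, gives the maximal one.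
\<close>

lemma poly_lower_bound_unit_circle:
  fixes p :: "complex poly"
  assumes p: "p \<noteq> 0"
  obtains c where "c > 0"
    "\<And>z e. \<lbrakk>cmod z = 1; 0 < e; e \<le> 1; \<And>w. \<lbrakk>cmod w = 1; poly p w = 0\<rbrakk> \<Longrightarrow> e \<le> dist z w\<rbrakk>
       \<Longrightarrow> c * e ^ max_mult_unit_circle p \<le> cmod (poly p z)"
proof -
  define t where "t = max_mult_unit_circle p"
  \<comment> \<open>Here \<open>e\<close> is a lower bound for the distance from \<open>z\<close> to
    the roots on the circle. The cap at 1 makes powers of \<open>e\<close> decrease with the
    exponent.\<close>
  define good where "good z e \<longleftrightarrow> 0 < e \<and> e \<le> 1 \<and>
    (\<forall>w. cmod w = 1 \<longrightarrow> poly p w = 0 \<longrightarrow> e \<le> dist z w)" for z e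
  \<comment> \<open>Local bound: near \<open>x\<close> the polynomial is comparable to a power of
    \<open>z - x\<close> with exponent the order at \<open>x\<close>, which is at most
    \<open>t\<close>.\<close>
  have "\<exists>U c. open U \<and> x \<in> U \<and> c > 0 \<and> (\<forall>z\<in>U. \<forall>e. good z e \<longrightarrow> c * e ^ t \<le> cmod (poly p z))"
    if x: "cmod x = 1" for x
  proof -
    obtain q where q: "p = [:- x, 1:] ^ order x p * q" "\<not> [:- x, 1:] dvd q"
      using order_decomp[OF p] by blast
    define c where "c = cmod (poly q x) / 2"
    define U where "U = {z. c < cmod (poly q z)}"
    have qx: "poly q x \<noteq> 0" using q(2) by (simp add: poly_eq_0_iff_dvd)
    then have "c > 0" "x \<in> U" by (auto simp: c_def U_def)
    moreover have "open U" unfolding U_def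
      by (intro open_Collect_less continuous_intros)
    moreover have "c * e ^ t \<le> cmod (poly p z)" if z: "z \<in> U" "good z e" for z e
    proof -
      have e: "0 < e" "e \<le> 1" using z(2) by (auto simp: good_def)
      have "e ^ t \<le> e ^ order x p"
        using e order_le_max_mult_unit_circle[OF p x] by (intro power_decreasing) (auto simp: t_def)
      \<comment> \<open>At a root \<open>x\<close>, \<open>good\<close> bounds \<open>e\<close> by
        the distance to \<open>x\<close>; at any other point the order is 0 and both sides are
        1.\<close>
      also have "\<dots> \<le> cmod (z - x) ^ order x p"
      proof (cases "poly p x = 0")
        case True
        then show ?thesis using z(2) x by (intro power_mono) (auto simp: good_def dist_norm)
      qed (simp add: order_root)
      finally have "e ^ t * c \<le> cmod (z - x) ^ order x p * cmod (poly q z)"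
        using z(1) \<open>c > 0\<close> by (intro mult_mono) (auto simp: U_def)
      also have "\<dots> = cmod (poly ([:- x, 1:] ^ order x p * q) z)"
        by (simp add: norm_mult norm_power)
      also have "\<dots> = cmod (poly p z)"
        by (simp only: q(1)[symmetric])
      finally show ?thesis by (simp add: mult.commute)
    qed
    ultimately show ?thesis by blast
  qed
  then obtain U c where U: "\<And>x. cmod x = 1 \<Longrightarrow> open (U x) \<and> x \<in> U x \<and> c x > 0 \<and>
      (\<forall>z\<in>U x. \<forall>e. good z e \<longrightarrow> c x * e ^ t \<le> cmod (poly p z))"
    by metis
  have "compact (sphere (0::complex) 1)" by simp
  moreover have "\<And>x. x \<in> sphere 0 1 \<Longrightarrow> open (U x)" "sphere 0 1 \<subseteq> (\<Union>x\<in>sphere 0 1. U x)"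
    using U by force+
  ultimately obtain F where F: "F \<subseteq> sphere 0 1" "finite F" "sphere 0 1 \<subseteq> (\<Union>x\<in>F. U x)"
    by (rule compactE_image)
  \<comment> \<open>Finitely many neighbourhoods cover the circle, so the smallest local constant is
    positive and works everywhere.\<close>
  define c0 where "c0 = Min (c ` F)"
  have "F \<noteq> {}" using F(3) norm_one[where 'a = complex] by force
  have "c0 > 0"
    unfolding c0_def using F U \<open>F \<noteq> {}\<close> by (subst Min_gr_iff) auto
  moreover have "c0 * e ^ t \<le> cmod (poly p z)" if "cmod z = 1" "good z e" for z e
  proof -
    have "z \<in> sphere 0 1" using that(1) by simp
    then obtain x where x: "x \<in> F" "z \<in> U x" using F(3) by blast
    have "c0 \<le> c x" unfolding c0_def using x F by auto
    then have "c0 * e ^ t \<le> c x * e ^ t"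
      using that by (intro mult_right_mono) (auto simp: good_def)
    also have "\<dots> \<le> cmod (poly p z)"
      using U[of x] x F that by auto
    finally show ?thesis .
  qed
  ultimately show ?thesis using that[of c0] by (auto simp: good_def t_def)
qed

text \<open>
  Pigeonhole: the \<open>n + 1\<close> roots of unity of order \<open>n + 1\<close> are separated, so \<open>n\<close> points cannot
  come close to each of them.
\<close>

lemma unit_circle_avoid:
  fixes n :: nat
  obtains \<delta> where "\<delta> > 0"
    "\<And>V. \<lbrakk>finite V; card V \<le> n\<rbrakk> \<Longrightarrow> \<exists>u. cmod u = 1 \<and> (\<forall>v\<in>V. \<delta> \<le> dist u v)"
proof -
  define P where "P = {z::complex. z ^ Suc n = 1}"
  have P: "finite P" "card P = Suc n"
    unfolding P_def by (auto simp only: card_roots_unity_eq finite_nth_roots zero_less_Suc)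
  have "\<exists>d>0. \<forall>x\<in>P. \<forall>y\<in>P. x \<noteq> y \<longrightarrow> d \<le> dist x y"
  proof -
    have "\<forall>x. \<exists>d>0. \<forall>y\<in>P. y \<noteq> x \<longrightarrow> d \<le> dist x y"
      using finite_set_avoid[OF P(1)] by blast
    then obtain d where d: "\<And>x. d x > 0 \<and> (\<forall>y\<in>P. y \<noteq> x \<longrightarrow> d x \<le> dist x y)" by metis
    have "P \<noteq> {}" using P by auto
    then have "Min (d ` P) > 0" using P d by simp
    moreover have "Min (d ` P) \<le> dist x y" if "x \<in> P" "y \<in> P" "x \<noteq> y" for x y
    proof -
      have "Min (d ` P) \<le> d x" using P(1) that(1) by simp
      also have "\<dots> \<le> dist x y" using d[of x] that by auto
      finally show ?thesis .
    qed
    ultimately show ?thesis by blast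
  qed
  then obtain d where d: "d > 0" "\<And>x y. x \<in> P \<Longrightarrow> y \<in> P \<Longrightarrow> x \<noteq> y \<Longrightarrow> d \<le> dist x y" by blast
  \<comment> \<open>With radius \<open>d / 2\<close>, no point of \<open>V\<close> can be close to
    two points of \<open>P\<close>, so assigning to each point of \<open>P\<close> a close point of
    \<open>V\<close> is injective. The radius depends on \<open>n\<close> only, not on
    \<open>V\<close>.\<close>
  have "\<exists>u. cmod u = 1 \<and> (\<forall>v\<in>V. d / 2 \<le> dist u v)" if V: "finite V" "card V \<le> n" for V
  proof -
    have "\<exists>u\<in>P. \<forall>v\<in>V. d / 2 \<le> dist u v"
    proof (rule ccontr)
      assume "\<not> ?thesis"
      then have "\<forall>u\<in>P. \<exists>v\<in>V. dist u v < d / 2" by (simp add: not_le)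
      then obtain f where f: "\<And>u. u \<in> P \<Longrightarrow> f u \<in> V \<and> dist u (f u) < d / 2"
        by metis
      have "inj_on f P"
      proof (rule inj_onI, rule ccontr)
        fix x y assume xy: "x \<in> P" "y \<in> P" "f x = f y" "x \<noteq> y"
        have "dist x y \<le> dist x (f x) + dist y (f x)" by (rule dist_triangle2)
        also have "\<dots> < d" using f[of x] f[of y] xy by simp
        finally show False using d(2)[of x y] xy by simp
      qed
      then have "card P \<le> card V" using f V by (intro card_inj_on_le[of f]) auto
      then show False using P V by simp
    qed
    then obtain u where u: "u \<in> P" "\<forall>v\<in>V. d / 2 \<le> dist u v" by blast
    have "cmod u ^ Suc n = 1" using u(1) by (simp only: P_def mem_Collect_eq flip: norm_power) simp
    then have "cmod u = 1" using power_eq_1_iff by fastforce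
    with u show ?thesis by blast
  qed
  then show ?thesis using d(1) by (intro that[of "d / 2"]) auto
qed

text \<open>The quotient of \<open>z ^ n - w ^ n\<close> by \<open>z - w\<close> is a sum of
  \<open>n\<close> products of modulus 1. Read backwards, separated powers force the points
  themselves apart.\<close>

lemma dist_power_le:
  fixes z w :: complex
  assumes "cmod z = 1" "cmod w = 1"
  shows "dist (z ^ n) (w ^ n) \<le> real n * dist z w"
  using norm_power_diff[of z w n] assms by (simp add: dist_norm)

lemma norm_eq_1_of_power:
  fixes z :: complex
  assumes "0 < N" "z ^ N = u" "cmod u = 1"
  shows "cmod z = 1"
proof -
  have "cmod z ^ N = 1" using assms(2,3) by (simp flip: norm_power)
  then show ?thesis using assms(1) power_eq_1_iff by fastforce
qed

section \<open>Asymptotics for a fixed coefficient vector\<close>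

context
  fixes r :: nat and a :: "real vec" and g :: "complex poly" and t :: nat
    and A :: "(nat \<Rightarrow> real) \<Rightarrow> nat \<Rightarrow> complex mat"
  assumes dim: "a \<in> carrier_vec (r + 1)"
    and nz: "a \<noteq> 0\<^sub>v (r + 1)"
  defines "g \<equiv> gen_poly a"
    and "t \<equiv> max_mult_unit_circle g"
    and "A \<equiv> \<lambda>\<alpha> N. circulant N (modulate (\<alpha> N) a)"
begin

lemma g_nonzero: "g \<noteq> 0"
  unfolding g_def using dim nz by (rule gen_poly_nonzero)

lemma A_carrier: "A \<alpha> N \<in> carrier_mat N N"
  by (simp add: A_def circulant_def)

lemma eigenvalue_A:
  assumes "r < N"
  shows "eigenvalue (A \<alpha> N) x \<longleftrightarrow> (\<exists>z. z ^ N = cis (- (real N * \<alpha> N)) \<and> x = poly g z)"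
  unfolding A_def g_def using assms dim by (intro eigenvalue_circulant_modulate) auto

lemma eigenvalue_A_E:
  assumes "r < N" "eigenvalue (A \<alpha> N) x"
  obtains z where "cmod z = 1" "z ^ N = cis (- (real N * \<alpha> N))" "x = poly g z"
proof -
  obtain z where z: "z ^ N = cis (- (real N * \<alpha> N))" "x = poly g z"
    using assms eigenvalue_A by blast
  have "cmod z = 1" by (rule norm_eq_1_of_power[OF _ z(1)]) (use assms(1) in auto)
  with z show ?thesis using that by blast
qed

text \<open>The common source of the upper bound for the smallest and the lower bound for the
  largest eigenvalue. The distance bound does not involve \<open>\<alpha>\<close>, which is why
  those bounds hold for every sequence.\<close>

lemma eigenvalue_A_near:
  assumes "r < N" "cmod z0 = 1"
  obtains z where "cmod z = 1" "dist z z0 \<le> 2 * pi / real N" "eigenvalue (A \<alpha> N) (poly g z)"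
proof -
  have "0 < N" using assms by simp
  obtain z where z: "z ^ N = cis (- (real N * \<alpha> N))" "dist z z0 \<le> 2 * pi / real N"
    using nearby_nth_root[OF assms(2) norm_cis \<open>0 < N\<close>] .
  have "cmod z = 1" by (rule norm_eq_1_of_power[OF \<open>0 < N\<close> z(1)]) simp
  with z show ?thesis using eigenvalue_A[OF assms(1)] by (intro that[of z]) auto
qed

text \<open>At an eigenvalue taken near a point \<open>z0\<close> of order \<open>t\<close>, the
  factor \<open>(z - z0) ^ t\<close> contributes the power of 1 / \<open>N\<close>, and the cofactor
  \<open>q\<close> is bounded on the circle.\<close>

lemma lambda_min_bigo: "(\<lambda>N. cmod (lambda_min (A \<alpha> N))) \<in> O(\<lambda>N. 1 / real N ^ t)"
proof -
  obtain z0 where z0: "cmod z0 = 1" "order z0 g = t"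
    using max_mult_unit_circle_attained[OF g_nonzero] t_def by metis
  obtain q where q: "g = [:- z0, 1:] ^ t * q"
    using order_decomp[OF g_nonzero, of z0] z0(2) by metis
  obtain M where M: "M > 0" "\<And>z. cmod z = 1 \<Longrightarrow> cmod (poly q z) \<le> M"
    using poly_bound_unit_circle[of q] by blast
  have "cmod (lambda_min (A \<alpha> N)) \<le> M * (2 * pi) ^ t * (1 / real N ^ t)" if N: "r < N" for N
  proof -
    obtain z where z: "cmod z = 1" "dist z z0 \<le> 2 * pi / real N" "eigenvalue (A \<alpha> N) (poly g z)"
      using eigenvalue_A_near[OF N z0(1)] .
    have "cmod (lambda_min (A \<alpha> N)) \<le> cmod (poly g z)"
      using lambda_min_le[OF A_carrier _ z(3)] N by simp
    also have "\<dots> = dist z z0 ^ t * cmod (poly q z)"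
      by (simp add: q norm_mult norm_power dist_norm)
    also have "\<dots> \<le> (2 * pi / real N) ^ t * M"
      using z M by (intro mult_mono power_mono) auto
    finally show ?thesis by (simp add: power_divide mult_ac)
  qed
  then show ?thesis
    by (intro bigoI[of _ "M * (2 * pi) ^ t"] eventually_mono[OF eventually_gt_at_top[of r]]) simp
qed

lemma lambda_max_bigtheta: "(\<lambda>N. cmod (lambda_max (A \<alpha> N))) \<in> \<Theta>(\<lambda>N. 1)"
proof (rule bigthetaI)
  obtain M where M: "M > 0" "\<And>z. cmod z = 1 \<Longrightarrow> cmod (poly g z) \<le> M"
    using poly_bound_unit_circle[of g] by blast
  have "cmod (lambda_max (A \<alpha> N)) \<le> M" if N: "r < N" for N
  proof -
    have "eigenvalue (A \<alpha> N) (lambda_max (A \<alpha> N))"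
      using eigenvalue_lambda_max[OF A_carrier] N by simp
    then show ?thesis using eigenvalue_A_E[OF N] M(2) by metis
  qed
  then show "(\<lambda>N. cmod (lambda_max (A \<alpha> N))) \<in> O(\<lambda>N. 1)"
    by (intro bigoI[of _ M] eventually_mono[OF eventually_gt_at_top[of r]]) simp
next
  \<comment> \<open>Otherwise \<open>g\<close> would vanish at all roots of unity of order
    \<open>Suc (degree g)\<close>, which are too many.\<close>
  have "\<exists>z0. cmod z0 = 1 \<and> poly g z0 \<noteq> 0"
  proof (rule ccontr)
    assume "\<not> ?thesis"
    then have "{z. z ^ Suc (degree g) = 1} \<subseteq> {z. poly g z = 0}"
      using norm_eq_1_of_power[of "Suc (degree g)" _ 1] by auto
    then have "Suc (degree g) \<le> card {z. poly g z = 0}"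
      using card_mono[OF poly_roots_finite[OF g_nonzero]] card_roots_unity_eq[OF zero_less_Suc]
      by metis
    with card_poly_roots_bound[OF g_nonzero] show False by simp
  qed
  then obtain z0 where z0: "cmod z0 = 1" "poly g z0 \<noteq> 0" by auto
  \<comment> \<open>Half the value at \<open>z0\<close> leaves room for \<open>c\<close> to remain a
    strict lower bound on a neighbourhood of \<open>z0\<close>.\<close>
  define c where "c = cmod (poly g z0) / 2"
  have "c > 0" using z0 by (simp add: c_def)
  have "open {z. c < cmod (poly g z)}" by (intro open_Collect_less continuous_intros)
  moreover have "c < cmod (poly g z0)" using z0(2) by (simp add: c_def)
  ultimately obtain d where d: "d > 0" "\<And>z. dist z z0 < d \<Longrightarrow> c < cmod (poly g z)"
    unfolding open_dist by blast
  have "(\<lambda>N. 2 * pi / real N) \<longlonglongrightarrow> 0" by (rule lim_const_over_n)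
  then have "eventually (\<lambda>N. 2 * pi / real N < d) sequentially"
    using d(1) by (rule order_tendstoD)
  then have "eventually (\<lambda>N. c \<le> cmod (lambda_max (A \<alpha> N))) sequentially"
    using eventually_gt_at_top[of r]
  proof eventually_elim
    case (elim N)
    obtain z where z: "cmod z = 1" "dist z z0 \<le> 2 * pi / real N" "eigenvalue (A \<alpha> N) (poly g z)"
      using eigenvalue_A_near[OF elim(2) z0(1)] .
    have "c < cmod (poly g z)" using d(2) z(2) elim(1) by simp
    also have "\<dots> \<le> cmod (lambda_max (A \<alpha> N))"
      using lambda_max_ge[OF A_carrier _ z(3)] elim by simp
    finally show ?case by simp
  qed
  then show "(\<lambda>N. cmod (lambda_max (A \<alpha> N))) \<in> \<Omega>(\<lambda>N. 1)"
    using \<open>c > 0\<close> by (intro landau_omega.bigI[of c]) (auto elim: eventually_mono)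
qed

text \<open>For each \<open>N\<close> the forbidden points are the \<open>N\<close>-th powers of the
  roots on the circle. There are at most \<open>card R\<close> of them whatever \<open>N\<close> is,
  so a single \<open>\<delta>\<close> serves all \<open>N\<close>.\<close>

lemma ex_lambda_min_bigtheta:
  "\<exists>\<alpha>. (\<lambda>N. cmod (lambda_min (A \<alpha> N))) \<in> \<Theta>(\<lambda>N. 1 / real N ^ t)"
proof -
  define R where "R = {w. cmod w = 1 \<and> poly g w = 0}"
  have R: "finite R"
    unfolding R_def by (rule finite_subset[OF _ poly_roots_finite[OF g_nonzero]]) auto
  obtain \<delta> where \<delta>: "\<delta> > 0"
      "\<And>V. \<lbrakk>finite V; card V \<le> card R\<rbrakk> \<Longrightarrow> \<exists>u. cmod u = 1 \<and> (\<forall>v\<in>V. \<delta> \<le> dist u v)"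
    using unit_circle_avoid[of "card R"] by metis
  have "\<exists>u. cmod u = 1 \<and> (\<forall>v\<in>(\<lambda>w. w ^ N) ` R. \<delta> \<le> dist u v)" for N
    using R by (intro \<delta>(2)) (auto intro: card_image_le)
  then obtain u where u: "\<And>N. cmod (u N) = 1" "\<And>N w. w \<in> R \<Longrightarrow> \<delta> \<le> dist (u N) (w ^ N)"
    by (metis imageI)
  \<comment> \<open>Chosen so that the eigenvalues of \<open>A \<alpha> N\<close> are the values of
    \<open>g\<close> at the \<open>N\<close>-th roots of \<open>u N\<close>. At \<open>N = 0\<close>
    the division yields 0, hence the condition \<open>0 < N\<close> in the next fact.\<close>
  define \<alpha> where "\<alpha> N = - Arg (u N) / real N" for N
  have \<alpha>: "cis (- (real N * \<alpha> N)) = u N" if "0 < N" for N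
    using that u(1)[of N] cis_Arg[of "u N"] by (cases "u N = 0") (auto simp: \<alpha>_def sgn_div_norm)
  obtain c where c: "c > 0"
      "\<And>z e. \<lbrakk>cmod z = 1; 0 < e; e \<le> 1; \<And>w. \<lbrakk>cmod w = 1; poly g w = 0\<rbrakk> \<Longrightarrow> e \<le> dist z w\<rbrakk>
         \<Longrightarrow> c * e ^ t \<le> cmod (poly g z)"
    using poly_lower_bound_unit_circle[OF g_nonzero] t_def by metis
  \<comment> \<open>The minimum with 1 ensures that \<open>d / real N\<close> is admissible as
    \<open>e\<close> in the lower bound.\<close>
  define d where "d = min \<delta> 1"
  have d: "0 < d" "d \<le> 1" "d \<le> \<delta>" using \<delta>(1) by (auto simp: d_def)
  have "c * d ^ t * (1 / real N ^ t) \<le> cmod (lambda_min (A \<alpha> N))" if N: "r < N" for N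
  proof -
    have "0 < N" using N by simp
    have "eigenvalue (A \<alpha> N) (lambda_min (A \<alpha> N))"
      using eigenvalue_lambda_min[OF A_carrier] N by simp
    then obtain z where z: "cmod z = 1" "z ^ N = u N" "lambda_min (A \<alpha> N) = poly g z"
      using eigenvalue_A_E[OF N] \<alpha>[OF \<open>0 < N\<close>] by metis
    have "c * (d / real N) ^ t \<le> cmod (poly g z)"
    proof (rule c(2)[OF z(1)])
      show "0 < d / real N" "d / real N \<le> 1" using d \<open>0 < N\<close> by (auto simp: field_simps)
      fix w assume w: "cmod w = 1" "poly g w = 0"
      have "d \<le> dist (z ^ N) (w ^ N)"
        using u(2)[of w N] w d z(2) by (auto simp: R_def)
      also have "\<dots> \<le> real N * dist z w" by (rule dist_power_le[OF z(1) w(1)])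
      finally show "d / real N \<le> dist z w" using \<open>0 < N\<close> by (simp add: field_simps)
    qed
    then show ?thesis by (simp add: z(3) power_divide)
  qed
  then have "(\<lambda>N. cmod (lambda_min (A \<alpha> N))) \<in> \<Omega>(\<lambda>N. 1 / real N ^ t)"
    using c(1) d(1)
    by (intro landau_omega.bigI[of "c * d ^ t"] eventually_mono[OF eventually_gt_at_top[of r]]) auto
  then show ?thesis using lambda_min_bigo by (blast intro: bigthetaI)
qed

end

theorem theorem4p1:
  fixes r :: nat and a :: "real vec" and t :: nat
  assumes "a \<in> carrier_vec (r + 1)"
    and "a \<noteq> 0\<^sub>v (r + 1)"
    and "t = max_mult_unit_circle (gen_poly a)"
  shows "(\<forall>\<alpha> :: nat \<Rightarrow> real.
            (\<lambda>N. cmod (lambda_min (circulant N (modulate (\<alpha> N) a)))) \<in> O(\<lambda>N. 1 / real N ^ t))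
       \<and> (\<forall>\<alpha> :: nat \<Rightarrow> real.
            (\<lambda>N. cmod (lambda_max (circulant N (modulate (\<alpha> N) a)))) \<in> \<Theta>(\<lambda>N. 1))
       \<and> (\<exists>\<alpha> :: nat \<Rightarrow> real.
            (\<lambda>N. cmod (lambda_min (circulant N (modulate (\<alpha> N) a)))) \<in> \<Theta>(\<lambda>N. 1 / real N ^ t))"
  unfolding assms(3)
  using lambda_min_bigo[OF assms(1,2)] lambda_max_bigtheta[OF assms(1,2)]
    ex_lambda_min_bigtheta[OF assms(1,2)]
  by blast

end
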